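(* Let $q$ be an odd prime and $c \geq 0$ an integer. Then neither $2^c q^3$ nor $2^c q^5$ is pristine.
   Context: For positive integers, write $m \lfloor n$ to mean that $m$ is a proper divisor of $n$. The number of recursive divisors is defined by $a(1)=1$ and $a(n) = 1 + \sum_{m \lfloor n} a(m)$ for $n>1$. A positive integer $n$ is pristine if $a(n) = n$. *)

theory Defs
  imports "HOL-Computational_Algebra.Primes"
begin

definition proper_divisor :: "nat \<Rightarrow> nat \<Rightarrow> bool"
  where "proper_divisor m n \<longleftrightarrow> m dvd n \<and> m < n"

(* Only meaningful for n > 0; the value at 0 is an artefact of totality
   (0 has no proper divisors in the above sense). *)
function num_recursive_divisors :: "nat \<Rightarrow> nat" where
  "num_recursive_divisors n =
     (if n = 1 then 1
      else 1 + (\<Sum>m | proper_divisor m n. num_recursive_divisors m))"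
  by pat_completeness auto
termination
  by (relation "measure id") (auto simp: proper_divisor_def)

(* The defining equation loops as a simplification rule. *)
declare num_recursive_divisors.simps [simp del]

lemma num_recursive_divisors_1: "num_recursive_divisors 1 = 1"
  by (simp add: num_recursive_divisors.simps)

lemma num_recursive_divisors_rec:
  "n > 1 \<Longrightarrow> num_recursive_divisors n =
     1 + (\<Sum>m | proper_divisor m n. num_recursive_divisors m)"
  by (subst num_recursive_divisors.simps) simp

definition pristine :: "nat \<Rightarrow> bool"
  where "pristine n \<longleftrightarrow> n > 0 \<and> num_recursive_divisors n = n"

end

(*
  Counting divisors gives 2 a(n) = 1 + sum of a(m) over all m dvd n.  For n = 2^c q^d the mixed
  difference of this identity is a linear recurrence, whose solution is 2^c P_d(c) with
  P_d(c) = sum_k (d choose k) (c+k choose k), so n is pristine iff P_d(c) = q^d.  For d = 3 and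
  d = 5 the polynomial d! P_d(c) has the factor c + d + 1, and its cofactor is congruent, up to sign, to a power
  of two modulo c + d + 1.  Hence the odd prime q divides at most one of the two factors, the other
  one divides d!, and only finitely many c remain; for these P_d(c) is even.
*)

theory Submission
  imports Defs
begin

text \<open>The recursion omits only the divisor n itself; adding a(n) to both sides completes the
  sum, so that it can be differenced later.\<close>

lemma twice_num_recursive_divisors:
  assumes "n > 0"
  shows "2 * num_recursive_divisors n = 1 + (\<Sum>m | m dvd n. num_recursive_divisors m)"
proof (cases "n = 1")
  case True
  then show ?thesis by (simp add: num_recursive_divisors_1 [simplified])
next
  case False
  have "{m. m dvd n} = insert n {m. proper_divisor m n}"
    using assms by (auto simp: proper_divisor_def dvd_imp_le le_neq_implies_less)
  moreover have "finite {m. proper_divisor m n}"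
    by (rule finite_subset [of _ "{..<n}"]) (auto simp: proper_divisor_def)
  ultimately have "(\<Sum>m | m dvd n. num_recursive_divisors m) =
      num_recursive_divisors n + (\<Sum>m | proper_divisor m n. num_recursive_divisors m)"
    by (simp add: proper_divisor_def)
  then show ?thesis
    using num_recursive_divisors_rec [of n] assms False by simp
qed

text \<open>Injective because multiplicities recover the exponents; surjective because a divisor of
  a product splits into divisors of the two factors.\<close>

lemma bij_betw_divisors_two_prime_powers:
  fixes p q :: nat
  assumes "prime p" "prime q" "p \<noteq> q"
  shows "bij_betw (\<lambda>(i, j). p ^ i * q ^ j) ({..c} \<times> {..d}) {m. m dvd p ^ c * q ^ d}"
proof -
  have mult: "multiplicity p (p ^ i * q ^ j) = i" "multiplicity q (p ^ i * q ^ j) = j" for i j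
    using assms
    by (simp_all add: prime_elem_multiplicity_mult_distrib multiplicity_distinct_prime_power)
  have "inj_on (\<lambda>(i, j). p ^ i * q ^ j) ({..c} \<times> {..d})"
    by (rule inj_on_inverseI [where g = "\<lambda>m. (multiplicity p m, multiplicity q m)"])
      (auto simp: mult)
  moreover have "(\<lambda>(i, j). p ^ i * q ^ j) ` ({..c} \<times> {..d}) = {m. m dvd p ^ c * q ^ d}"
  proof
    show "(\<lambda>(i, j). p ^ i * q ^ j) ` ({..c} \<times> {..d}) \<subseteq> {m. m dvd p ^ c * q ^ d}"
      by (auto intro!: mult_dvd_mono le_imp_power_dvd)
  next
    show "{m. m dvd p ^ c * q ^ d} \<subseteq> (\<lambda>(i, j). p ^ i * q ^ j) ` ({..c} \<times> {..d})"
    proof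
      fix m assume "m \<in> {m. m dvd p ^ c * q ^ d}"
      then obtain a b where m: "m = a * b" "a dvd p ^ c" "b dvd q ^ d"
        using division_decomp by blast
      then obtain i j where "i \<le> c" "a = p ^ i" "j \<le> d" "b = q ^ j"
        using assms by (auto simp: divides_primepow_nat)
      with m show "m \<in> (\<lambda>(i, j). p ^ i * q ^ j) ` ({..c} \<times> {..d})" by auto
    qed
  qed
  ultimately show ?thesis by (simp add: bij_betw_def)
qed

lemma twice_num_recursive_divisors_two_prime_powers:
  fixes p q :: nat
  assumes "prime p" "prime q" "p \<noteq> q"
  shows "2 * num_recursive_divisors (p ^ c * q ^ d) =
    1 + (\<Sum>i\<le>c. \<Sum>j\<le>d. num_recursive_divisors (p ^ i * q ^ j))"
proof -
  have "p ^ c * q ^ d > 0"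
    using assms by (simp add: prime_gt_0_nat)
  then show ?thesis
    using sum.reindex_bij_betw [OF bij_betw_divisors_two_prime_powers [OF assms, of c d],
        of num_recursive_divisors]
    by (simp add: twice_num_recursive_divisors sum.cartesian_product case_prod_unfold)
qed

text \<open>This is P_d(c), the coefficient of x^c y^d in 1/(1 - x - 2y + xy). The name recalls that
  a(n) counts strictly increasing divisor chains ending in n.\<close>

definition chain_coeff :: "nat \<Rightarrow> nat \<Rightarrow> nat"
  where "chain_coeff c d = (\<Sum>k\<le>d. (d choose k) * ((c + k) choose k))"

lemma chain_coeff_0_left [simp]: "chain_coeff 0 d = 2 ^ d"
  by (simp add: chain_coeff_def choose_row_sum)

lemma chain_coeff_0_right [simp]: "chain_coeff c 0 = 1"
  by (simp add: chain_coeff_def)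

lemma chain_coeff_Suc_right:
  "chain_coeff c (Suc d) = chain_coeff c d + (\<Sum>k\<le>d. (d choose k) * ((c + Suc k) choose Suc k))"
proof -
  have "chain_coeff c (Suc d) = 1 + (\<Sum>k\<le>d. (Suc d choose Suc k) * ((c + Suc k) choose Suc k))"
    unfolding chain_coeff_def by (subst sum.atMost_Suc_shift) simp
  also have "\<dots> = 1 + (\<Sum>k\<le>d. (d choose Suc k) * ((c + Suc k) choose Suc k))
      + (\<Sum>k\<le>d. (d choose k) * ((c + Suc k) choose Suc k))"
    by (simp add: algebra_simps sum.distrib)
  also have "1 + (\<Sum>k\<le>d. (d choose Suc k) * ((c + Suc k) choose Suc k)) =
      (\<Sum>k\<le>Suc d. (d choose k) * ((c + k) choose k))"
    by (subst sum.atMost_Suc_shift) simp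
  \<comment> \<open>The extra term \<open>k = Suc d\<close> vanishes, since
    \<open>d choose Suc d = 0\<close>.\<close>
  also have "\<dots> = chain_coeff c d"
    by (simp add: chain_coeff_def)
  finally show ?thesis .
qed

text \<open>Pascal's rule on the second binomial, applied to the increment in
  \<open>chain_coeff_Suc_right\<close>. Terms are moved across to avoid subtraction on
  \<open>nat\<close>.\<close>

lemma chain_coeff_Suc_Suc:
  "chain_coeff (Suc c) (Suc d) + chain_coeff c d =
    chain_coeff c (Suc d) + 2 * chain_coeff (Suc c) d"
proof -
  have "(\<Sum>k\<le>d. (d choose k) * ((Suc c + Suc k) choose Suc k)) =
      chain_coeff (Suc c) d + (\<Sum>k\<le>d. (d choose k) * ((c + Suc k) choose Suc k))"
    by (simp add: chain_coeff_def algebra_simps sum.distrib)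
  then show ?thesis
    by (simp add: chain_coeff_Suc_right)
qed

text \<open>Scaling by \<open>2 ^ c\<close> turns the recurrence of
  \<open>chain_coeff_Suc_Suc\<close> into that of a(n), and the values on both axes agree.\<close>

lemma num_recursive_divisors_two_prime_powers:
  fixes p q :: nat
  assumes "prime p" "prime q" "p \<noteq> q"
  shows "num_recursive_divisors (p ^ c * q ^ d) = 2 ^ c * chain_coeff c d"
proof -
  define g where "g i j = num_recursive_divisors (p ^ i * q ^ j)" for i j
  have g: "2 * g i j = 1 + (\<Sum>k\<le>i. \<Sum>l\<le>j. g k l)" for i j
    unfolding g_def by (rule twice_num_recursive_divisors_two_prime_powers [OF assms])
  have g00: "g 0 0 = 1"
    using g [of 0 0] by simp
  have g0: "g 0 (Suc j) = 2 * g 0 j" for j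
    using g [of 0 j] g [of 0 "Suc j"] by simp
  have g1: "g (Suc i) 0 = 2 * g i 0" for i
    using g [of i 0] g [of "Suc i" 0] by simp
  \<comment> \<open>In the mixed difference the four rectangular sums cancel down to the corner term
    \<open>g (Suc i) (Suc j)\<close>.\<close>
  have rec: "g (Suc i) (Suc j) + 2 * g i j = 2 * g i (Suc j) + 2 * g (Suc i) j" for i j
    using g [of i j] g [of "Suc i" j] g [of i "Suc j"] g [of "Suc i" "Suc j"]
    by (simp add: sum.distrib)
  have "g c d = 2 ^ c * chain_coeff c d"
  proof (induction c arbitrary: d)
    case 0
    show ?case by (induction d) (simp_all add: g00 g0)
  next
    case (Suc c)
    note IH = Suc.IH
    show ?case
    proof (induction d)
      case 0
      show ?case using IH [of 0] by (simp add: g1)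
    next
      case (Suc d)
      have "g (Suc c) (Suc d) + 2 ^ Suc c * chain_coeff c d =
          2 ^ Suc c * (chain_coeff c (Suc d) + 2 * chain_coeff (Suc c) d)"
        using rec [of c d] by (simp add: IH Suc.IH algebra_simps)
      also have "\<dots> = 2 ^ Suc c * chain_coeff (Suc c) (Suc d) + 2 ^ Suc c * chain_coeff c d"
        by (simp only: chain_coeff_Suc_Suc [symmetric] distrib_left)
      finally show ?case by simp
    qed
  qed
  then show ?thesis by (simp add: g_def)
qed

text \<open>With p = 2 the factor \<open>2 ^ c\<close> occurs in both a(n) and n, and
  cancels.\<close>

lemma pristine_iff_chain_coeff:
  assumes "prime q" "odd q"
  shows "pristine (2 ^ c * q ^ d) \<longleftrightarrow> chain_coeff c d = q ^ d"
proof -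
  have "q \<noteq> 2" using assms by auto
  then show ?thesis
    using num_recursive_divisors_two_prime_powers [of 2 q c d] assms
    by (auto simp: pristine_def prime_gt_0_nat)
qed

lemma binomial_add_numeral:
  fixes c :: nat
  shows "(c + 1) choose 1 = c + 1"
    and "2 * ((c + 2) choose 2) = (c + 2) * (c + 1)"
    and "6 * ((c + 3) choose 3) = (c + 3) * (c + 2) * (c + 1)"
    and "24 * ((c + 4) choose 4) = (c + 4) * (c + 3) * (c + 2) * (c + 1)"
    and "120 * ((c + 5) choose 5) = (c + 5) * (c + 4) * (c + 3) * (c + 2) * (c + 1)"
proof -
  \<comment> \<open>The absorption identity; iterating it clears the denominators k!.\<close>
  have step: "(k + 1) * ((c + (k + 1)) choose (k + 1)) = (c + (k + 1)) * ((c + k) choose k)" for k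
    using Suc_times_binomial_eq [of "c + k" k] by (simp add: mult.commute)
  show 1: "(c + 1) choose 1 = c + 1" by simp
  show 2: "2 * ((c + 2) choose 2) = (c + 2) * (c + 1)"
    using step [of 1] by (simp only: one_add_one 1)
  have "6 * ((c + 3) choose 3) = (c + 3) * (2 * ((c + 2) choose 2))"
    using step [of 2] by simp
  then show 3: "6 * ((c + 3) choose 3) = (c + 3) * (c + 2) * (c + 1)"
    by (simp only: 2 mult.assoc)
  have "24 * ((c + 4) choose 4) = (c + 4) * (6 * ((c + 3) choose 3))"
    using step [of 3] by simp
  then show 4: "24 * ((c + 4) choose 4) = (c + 4) * (c + 3) * (c + 2) * (c + 1)"
    by (simp only: 3 mult.assoc)
  have "120 * ((c + 5) choose 5) = (c + 5) * (24 * ((c + 4) choose 4))"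
    using step [of 4] by simp
  then show "120 * ((c + 5) choose 5) = (c + 5) * (c + 4) * (c + 3) * (c + 2) * (c + 1)"
    by (simp only: 4 mult.assoc)
qed

text \<open>The linear factor is no accident: at c = -d-1 the k-th summand of P_d becomes (-1)^k (d
  choose k)^2, and for odd d these cancel in pairs.\<close>

lemma chain_coeff_3: "6 * chain_coeff c 3 = (c + 4) * (c ^ 2 + 11 * c + 12)"
proof -
  have "(3::nat) choose 1 = 3" "(3::nat) choose 2 = 3"
    by (simp_all add: eval_nat_numeral)
  then have "chain_coeff c 3 =
      1 + 3 * ((c + 1) choose 1) + 3 * ((c + 2) choose 2) + ((c + 3) choose 3)"
    by (simp add: chain_coeff_def atMost_nat_numeral)
  then have "6 * chain_coeff c 3 = 6 + 18 * ((c + 1) choose 1)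
      + 9 * (2 * ((c + 2) choose 2)) + 6 * ((c + 3) choose 3)"
    by simp
  also have "\<dots> = (c + 4) * (c ^ 2 + 11 * c + 12)"
    unfolding binomial_add_numeral by (simp add: algebra_simps power2_eq_square)
  finally show ?thesis .
qed

lemma chain_coeff_5:
  "120 * chain_coeff c 5 = (c + 6) * (c ^ 4 + 34 * c ^ 3 + 331 * c ^ 2 + 914 * c + 640)"
proof -
  have "(5::nat) choose 1 = 5" "(5::nat) choose 2 = 10" "(5::nat) choose 3 = 10"
    "(5::nat) choose 4 = 5"
    by (simp_all add: eval_nat_numeral)
  then have "chain_coeff c 5 = 1 + 5 * ((c + 1) choose 1) + 10 * ((c + 2) choose 2)
      + 10 * ((c + 3) choose 3) + 5 * ((c + 4) choose 4) + ((c + 5) choose 5)"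
    by (simp add: chain_coeff_def atMost_nat_numeral)
  then have "120 * chain_coeff c 5 = 120 + 600 * ((c + 1) choose 1)
      + 600 * (2 * ((c + 2) choose 2)) + 200 * (6 * ((c + 3) choose 3))
      + 25 * (24 * ((c + 4) choose 4)) + 120 * ((c + 5) choose 5)"
    by simp
  also have "\<dots> = (c + 6) * (c ^ 4 + 34 * c ^ 3 + 331 * c ^ 2 + 914 * c + 640)"
    unfolding binomial_add_numeral
    by (simp add: algebra_simps power2_eq_square power3_eq_cube power4_eq_xxxx)
  finally show ?thesis .
qed

text \<open>A factor not divisible by q is coprime to \<open>q ^ d\<close>, hence divides the
  cofactor k.\<close>

lemma prime_power_mult_eq_mult_imp_dvd:
  fixes q k a b :: nat
  assumes "prime q" and eq: "k * q ^ d = a * b" and "\<not> (q dvd a \<and> q dvd b)"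
  shows "a dvd k \<or> b dvd k"
proof -
  consider "coprime q a" | "coprime q b"
    using assms prime_imp_coprime by blast
  then show ?thesis
  proof cases
    case 1
    then have "coprime a (q ^ d)" by (simp add: coprime_commute)
    moreover have "a dvd k * q ^ d" by (simp add: eq)
    ultimately show ?thesis by (simp add: coprime_dvd_mult_left_iff)
  next
    case 2
    then have "coprime b (q ^ d)" by (simp add: coprime_commute)
    moreover have "b dvd k * q ^ d" by (simp add: eq)
    ultimately show ?thesis by (simp add: coprime_dvd_mult_left_iff)
  qed
qed

lemma odd_prime_not_dvd_power_two:
  fixes q :: nat
  assumes "prime q" "odd q"
  shows "\<not> q dvd 2 ^ n"
proof
  assume "q dvd 2 ^ n"
  then have "q dvd 2" using assms(1) prime_dvd_power by blast
  then show False using assms primes_dvd_imp_eq two_is_prime_nat by blast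
qed

lemma chain_coeff_3_neq_cube:
  assumes "prime q" "odd q"
  shows "chain_coeff c 3 \<noteq> q ^ 3"
proof
  define Q where "Q = c ^ 2 + 11 * c + 12"
  assume "chain_coeff c 3 = q ^ 3"
  then have eq: "6 * q ^ 3 = (c + 4) * Q"
    using chain_coeff_3 [of c] by (simp add: Q_def)
  \<comment> \<open>As a polynomial, Q takes the value -2^4 at c = -4.\<close>
  have "Q + 2 ^ 4 = (c + 4) * (c + 7)"
    by (simp add: Q_def algebra_simps power2_eq_square)
  then have "q dvd 2 ^ 4" if "q dvd c + 4" "q dvd Q"
    using that by (metis dvd_add_right_iff dvd_mult2)
  then have "\<not> (q dvd c + 4 \<and> q dvd Q)"
    using odd_prime_not_dvd_power_two [OF assms] by blast
  moreover have "Q > 6" by (simp add: Q_def)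
  then have "\<not> Q dvd 6" by (simp add: nat_dvd_not_less)
  ultimately have dvd: "c + 4 dvd 6"
    using prime_power_mult_eq_mult_imp_dvd [OF assms(1) eq] by blast
  then have "c \<le> 2" by (auto dest!: dvd_imp_le)
  \<comment> \<open>Only c = 2 survives, with product 6 * 38. The modulus 12 = 2 * 6 makes
    \<open>q ^ 3\<close> even.\<close>
  moreover have "\<forall>c\<in>{..2::nat}. c + 4 dvd 6 \<longrightarrow> 12 dvd (c + 4) * (c ^ 2 + 11 * c + 12)"
    by (simp add: atMost_nat_numeral atMost_Suc)
  ultimately have "12 dvd 6 * q ^ 3"
    using dvd by (simp add: eq Q_def)
  then have "even (q ^ 3)" by presburger
  with assms show False by simp
qed

lemma chain_coeff_5_neq_fifth_power:
  assumes "prime q" "odd q"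
  shows "chain_coeff c 5 \<noteq> q ^ 5"
proof
  define Q where "Q = c ^ 4 + 34 * c ^ 3 + 331 * c ^ 2 + 914 * c + 640"
  assume "chain_coeff c 5 = q ^ 5"
  then have eq: "120 * q ^ 5 = (c + 6) * Q"
    using chain_coeff_5 [of c] by (simp add: Q_def)
  \<comment> \<open>Division by c + 6 leaves the remainder 2^10; the constant term -64 of the
    quotient is moved to the left to stay within \<open>nat\<close>.\<close>
  have "Q + (c + 6) * 64 = (c + 6) * (c ^ 3 + 28 * c ^ 2 + 163 * c) + 2 ^ 10"
    by (simp add: Q_def algebra_simps power2_eq_square power3_eq_cube power4_eq_xxxx)
  then have "q dvd 2 ^ 10" if "q dvd c + 6" "q dvd Q"
    using that dvd_add_right_iff [of q "(c + 6) * (c ^ 3 + 28 * c ^ 2 + 163 * c)" "2 ^ 10"]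
      dvd_add [of q Q "(c + 6) * 64"] by (metis dvd_mult2)
  then have "\<not> (q dvd c + 6 \<and> q dvd Q)"
    using odd_prime_not_dvd_power_two [OF assms] by blast
  moreover have "Q > 120" by (simp add: Q_def)
  then have "\<not> Q dvd 120" by (simp add: nat_dvd_not_less)
  ultimately have dvd: "c + 6 dvd 120"
    using prime_power_mult_eq_mult_imp_dvd [OF assms(1) eq] by blast
  then have "c \<le> 114" by (auto dest!: dvd_imp_le)
  \<comment> \<open>The bound is 120 - 6; the modulus 240 = 2 * 120 again forces evenness, now of
    \<open>q ^ 5\<close>.\<close>
  moreover have "\<forall>c\<in>{..114::nat}. c + 6 dvd 120 \<longrightarrow>
      240 dvd (c + 6) * (c ^ 4 + 34 * c ^ 3 + 331 * c ^ 2 + 914 * c + 640)"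
    by (simp add: atMost_nat_numeral atMost_Suc)
  ultimately have "240 dvd 120 * q ^ 5"
    using dvd by (simp add: eq Q_def)
  then have "even (q ^ 5)" by presburger
  with assms show False by simp
qed

theorem theorem5:
  fixes q c :: nat
  assumes "prime q" and "odd q"
  shows "\<not> pristine (2 ^ c * q ^ 3) \<and> \<not> pristine (2 ^ c * q ^ 5)"
  using chain_coeff_3_neq_cube [OF assms] chain_coeff_5_neq_fifth_power [OF assms]
  by (simp add: pristine_iff_chain_coeff [OF assms])

end
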